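(* Let $F$ be a monic polynomial with complex coefficients, of degree $n$. Then there exists a (sufficiently large) real number $\lambda>0$ such that the $\lambda$-Blaschke factorization $F(z)=B_\lambda(z)\cdot G(z)$ satisfies $$\left\|\frac{1}{\lambda^n}\cdot G\right\|_{\mathcal D}^2\ \le\ \frac12\,\|F\|_{\mathcal D}^2 .$$
   Context: $r$-Blaschke factorization: for $r>0$ and a nonzero polynomial $P$, let $$B_r(z)=\prod_i\frac{(z-\beta_i)\,r}{r^2-\overline{\beta_i}z},$$ the product being over the roots $\beta_i$ of $P$, counted with multiplicity, with $|\beta_i|<r$. The $r$-Blaschke factorization of $P$ is $P=B_r\cdot G$; here $G=P/B_r$ is the polynomial obtained from $P$ by replacing each factor $z-\beta_i$ with $|\beta_i|<r$ by $\frac1r(r^2-\overline{\beta_i}z)$. Dirichlet (semi)norm: for $f(z)=\sum_{k\ge 0}a_kz^k$, $\|f\|_{\mathcal D}^2=\sum_{k\ge 1}k|a_k|^2$. *)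

theory Defs
  imports "HOL-Computational_Algebra.Fundamental_Theorem_Algebra"
begin

definition blaschke_product :: "real \<Rightarrow> complex poly \<Rightarrow> complex \<Rightarrow> complex" where
  "blaschke_product r P z =
     (\<Prod>\<beta>\<in>#filter_mset (\<lambda>\<beta>. cmod \<beta> < r) (proots P).
        (z - \<beta>) * of_real r / (of_real r ^ 2 - cnj \<beta> * z))"

(* The polynomial G of the factorization P = B_r * G. The leading coefficient and the
   linear factors of the roots with |\<beta>| \<ge> r are left unchanged. *)
definition blaschke_cofactor :: "real \<Rightarrow> complex poly \<Rightarrow> complex poly" where
  "blaschke_cofactor r P =
     smult (lead_coeff P)
       (\<Prod>\<beta>\<in>#proots P.
          if cmod \<beta> < r then smult (1 / of_real r) [:of_real r ^ 2, - cnj \<beta>:]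
          else [:- \<beta>, 1:])"

definition dirichlet_norm :: "complex poly \<Rightarrow> real" where
  "dirichlet_norm f = sqrt (\<Sum>k=1..degree f. real k * (cmod (coeff f k))\<^sup>2)"

lemma dirichlet_norm_squared:
  "(dirichlet_norm f)\<^sup>2 = (\<Sum>k=1..degree f. real k * (cmod (coeff f k))\<^sup>2)"
  unfolding dirichlet_norm_def by (intro real_sqrt_pow2 sum_nonneg) simp

(* Away from the poles of B_r, where division would silently yield 0. *)
lemma blaschke_factorization:
  assumes "r > 0"
    and "\<And>\<beta>. \<beta> \<in># proots P \<Longrightarrow> cmod \<beta> < r \<Longrightarrow> of_real r ^ 2 - cnj \<beta> * z \<noteq> 0"
  shows "poly P z = blaschke_product r P z * poly (blaschke_cofactor r P) z"
proof -
  let ?b = "\<lambda>\<beta>. (z - \<beta>) * of_real r / (of_real r ^ 2 - cnj \<beta> * z)"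
  let ?g = "\<lambda>\<beta>. if cmod \<beta> < r then smult (1 / of_real r) [:of_real r ^ 2, - cnj \<beta>:]
                  else [:- \<beta>, 1:]"
  have regroup: "w * m = (b * c) * (g * d)" if "w = b * g" "m = c * d"
    for w m b c g d :: complex
    using that by simp
  have "(\<Prod>\<beta>\<in>#M. z - \<beta>) =
          (\<Prod>\<beta>\<in>#filter_mset (\<lambda>\<beta>. cmod \<beta> < r) M. ?b \<beta>) * (\<Prod>\<beta>\<in>#M. poly (?g \<beta>) z)"
    if "\<And>\<beta>. \<beta> \<in># M \<Longrightarrow> cmod \<beta> < r \<Longrightarrow> of_real r ^ 2 - cnj \<beta> * z \<noteq> 0" for M
    using that
  proof (induction M)
    case (add x M)
    have IH: "(\<Prod>\<beta>\<in>#M. z - \<beta>) =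
          (\<Prod>\<beta>\<in>#filter_mset (\<lambda>\<beta>. cmod \<beta> < r) M. ?b \<beta>) * (\<Prod>\<beta>\<in>#M. poly (?g \<beta>) z)"
      by (rule add.IH) (use add.prems in auto)
    show ?case
    proof (cases "cmod x < r")
      case True
      have "of_real r ^ 2 - cnj x * z \<noteq> 0" using add.prems[of x] True by simp
      moreover have "poly (?g x) z = (of_real r ^ 2 - cnj x * z) / of_real r"
        using True assms(1) by (simp add: field_simps)
      ultimately have "z - x = ?b x * poly (?g x) z"
        using assms(1) by simp
      from this IH
      have "(z - x) * (\<Prod>\<beta>\<in>#M. z - \<beta>) =
              (?b x * (\<Prod>\<beta>\<in>#filter_mset (\<lambda>\<beta>. cmod \<beta> < r) M. ?b \<beta>)) *
              (poly (?g x) z * (\<Prod>\<beta>\<in>#M. poly (?g \<beta>) z))"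
        by (rule regroup)
      then show ?thesis using True
        by (simp only: image_mset_add_mset prod_mset.add_mset filter_mset_add_mset if_True)
    next
      case False
      then show ?thesis using IH by simp
    qed
  qed simp
  from this[of "proots P"] assms(2)
  have *: "(\<Prod>\<beta>\<in>#proots P. z - \<beta>) = blaschke_product r P z * (\<Prod>\<beta>\<in>#proots P. poly (?g \<beta>) z)"
    unfolding blaschke_product_def by blast
  have poly_prod: "poly (\<Prod>\<beta>\<in>#M. h \<beta>) z = (\<Prod>\<beta>\<in>#M. poly (h \<beta>) z)"
    for M and h :: "complex \<Rightarrow> complex poly"
    by (induction M) simp_all
  have "poly P z = poly (smult (lead_coeff P) (\<Prod>\<beta>\<in>#proots P. [:- \<beta>, 1:])) z"
    by (simp only: complex_poly_decompose_multiset)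
  also have "\<dots> = lead_coeff P * (\<Prod>\<beta>\<in>#proots P. z - \<beta>)"
    by (simp add: poly_prod)
  also have "\<dots> = blaschke_product r P z * poly (blaschke_cofactor r P) z"
    unfolding blaschke_cofactor_def * poly_smult poly_prod by (simp only: mult_ac)
  finally show ?thesis .
qed

end

theory Submission
  imports Defs
begin

text \<open>
  For a real number \<open>lam\<close> that exceeds the modulus of every root \<open>\<beta>\<close> of the monic polynomial \<open>F\<close>, all
  roots are reflected, and dividing each factor \<open>(lam\<^sup>2 - cnj \<beta> * z) / lam\<close> of the cofactor by
  \<open>lam\<close> leaves \<open>1 - cnj \<beta> * (z / lam\<^sup>2)\<close>. Hence the normalized cofactor is \<open>Q (z / lam\<^sup>2)\<close>, where
  the polynomial \<open>Q (w) = (\<Prod>\<beta>. 1 - cnj \<beta> * w)\<close> does not depend on \<open>lam\<close>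
  (lemma \<open>blaschke_cofactor_eq_dilation\<close>). The dilation multiplies the \<open>k\<close>-th coefficient of \<open>Q\<close>
  by \<open>lam\<close> to the power \<open>-2 * k\<close>, and the Dirichlet seminorm ignores the constant term, so the
  seminorm of \<open>Q (z / lam\<^sup>2)\<close> tends to \<open>0\<close> as \<open>lam\<close> grows (lemma \<open>dirichlet_norm_dilation_le\<close>). On the
  other hand the leading term of \<open>F\<close> alone contributes \<open>degree F\<close> to its squared seminorm (lemma
  \<open>dirichlet_norm_ge_lead_coeff\<close>), which is at least \<open>1\<close> unless \<open>F\<close> is constant.
\<close>

text \<open>
  For a monic polynomial \<open>P\<close> of degree \<open>n\<close> this is \<open>z ^ n * cnj (P (1 / cnj z))\<close>, the polynomial with
  the conjugated coefficients of \<open>P\<close> in reverse order.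
\<close>
definition conj_reciprocal :: "complex poly \<Rightarrow> complex poly" where
  "conj_reciprocal P = (\<Prod>\<beta>\<in>#proots P. [:1, - cnj \<beta>:])"

text \<open>
  Each reflected factor is \<open>r\<close> times the dilation of \<open>1 - cnj \<beta> * w\<close> to \<open>w = z / r\<^sup>2\<close>. Dilation
  is multiplicative and there are \<open>degree P\<close> roots, so both effects can be pulled out of the product.
\<close>
lemma blaschke_cofactor_eq_dilation:
  assumes "r > 0" and "\<And>\<beta>. \<beta> \<in># proots P \<Longrightarrow> cmod \<beta> < r"
  shows "blaschke_cofactor r P =
           smult (lead_coeff P * of_real r ^ degree P)
             (pcompose (conj_reciprocal P) [:0, 1 / of_real r ^ 2:])"
proof -
  have factor: "smult (1 / of_real r) [:of_real r ^ 2, - cnj \<beta>:] =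
                  smult (of_real r) (pcompose [:1, - cnj \<beta>:] [:0, 1 / of_real r ^ 2:])" for \<beta>
    using assms(1) by (simp add: pcompose_pCons power2_eq_square)
  have "(\<Prod>\<beta>\<in>#M. if cmod \<beta> < r then smult (1 / of_real r) [:of_real r ^ 2, - cnj \<beta>:]
                   else [:- \<beta>, 1:]) =
          smult (of_real r ^ size M)
            (pcompose (\<Prod>\<beta>\<in>#M. [:1, - cnj \<beta>:]) [:0, 1 / of_real r ^ 2:])"
    if "\<And>\<beta>. \<beta> \<in># M \<Longrightarrow> cmod \<beta> < r" for M
    using that
  proof (induction M)
    case (add x M)
    have IH: "(\<Prod>\<beta>\<in>#M. if cmod \<beta> < r then smult (1 / of_real r) [:of_real r ^ 2, - cnj \<beta>:]
                   else [:- \<beta>, 1:]) =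
          smult (of_real r ^ size M)
            (pcompose (\<Prod>\<beta>\<in>#M. [:1, - cnj \<beta>:]) [:0, 1 / of_real r ^ 2:])"
      by (rule add.IH) (use add.prems in auto)
    have x: "cmod x < r" using add.prems by simp
    show ?case
      by (simp only: image_mset_add_mset prod_mset.add_mset x if_True IH, simp only: factor)
        (simp only: size_add_mset pcompose_mult mult_smult_left mult_smult_right smult_smult
          power_Suc2)
  qed (simp add: pcompose_1)
  from this[OF assms(2)] show ?thesis
    by (simp add: blaschke_cofactor_def conj_reciprocal_def size_proots_complex)
qed

text \<open>
  The \<open>k\<close>-th coefficient is multiplied by \<open>c ^ k\<close>, and only the terms with \<open>k \<ge> 1\<close> count; when
  \<open>cmod c \<le> 1\<close> their factors all have modulus at most \<open>cmod c\<close>.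
\<close>
lemma dirichlet_norm_dilation_le:
  assumes "cmod c \<le> 1" and "c \<noteq> 0"
  shows "(dirichlet_norm (pcompose p [:0, c:]))\<^sup>2 \<le> (cmod c)\<^sup>2 * (dirichlet_norm p)\<^sup>2"
proof -
  have deg: "degree (pcompose p [:0, c:]) = degree p"
    using assms(2) by (simp add: degree_pcompose)
  have le: "real k * (cmod (c ^ k * coeff p k))\<^sup>2 \<le> (cmod c)\<^sup>2 * (real k * (cmod (coeff p k))\<^sup>2)"
    if "k \<in> {1..degree p}" for k
  proof -
    have "cmod c ^ k \<le> cmod c ^ 1"
      by (rule power_decreasing) (use that assms(1) in auto)
    then have "(cmod c ^ k)\<^sup>2 \<le> (cmod c)\<^sup>2"
      by (intro power_mono) auto
    then have "(cmod c ^ k)\<^sup>2 * (real k * (cmod (coeff p k))\<^sup>2)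
                 \<le> (cmod c)\<^sup>2 * (real k * (cmod (coeff p k))\<^sup>2)"
      by (rule mult_right_mono) simp
    then show ?thesis
      by (simp add: norm_mult norm_power power_mult_distrib mult_ac)
  qed
  show ?thesis
    unfolding dirichlet_norm_squared deg coeff_pcompose_linear sum_distrib_left
    by (rule sum_mono) (rule le)
qed

lemma dirichlet_norm_ge_lead_coeff:
  "real (degree p) * (cmod (lead_coeff p))\<^sup>2 \<le> (dirichlet_norm p)\<^sup>2"
proof (cases "degree p = 0")
  case False
  then show ?thesis
    unfolding dirichlet_norm_squared
    by (intro member_le_sum[of "degree p" _ "\<lambda>k. real k * (cmod (coeff p k))\<^sup>2"]) auto
qed simp

theorem proposition2p2:
  fixes F :: "complex poly" and n :: nat
  assumes "lead_coeff F = 1" and "degree F = n"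
  shows "\<exists>lam::real. lam > 0 \<and>
           (dirichlet_norm (smult (1 / of_real lam ^ n) (blaschke_cofactor lam F)))\<^sup>2
             \<le> 1 / 2 * (dirichlet_norm F)\<^sup>2"
proof (cases "n = 0")
  case True
  then have "F = 1"
    using assms by (auto elim!: degree_eq_zeroE simp: one_pCons)
  then show ?thesis
    using True by (intro exI[of _ 1]) (simp add: blaschke_cofactor_def dirichlet_norm_def)
next
  case False
  define C where "C = (dirichlet_norm (conj_reciprocal F))\<^sup>2"
  define M where "M = (\<Sum>\<beta>\<in>set_mset (proots F). cmod \<beta>)"
  \<comment> \<open>The summand \<open>2 * C\<close> makes the squared seminorm after the dilation at most \<open>1 / 2\<close>; the
    summand \<open>M\<close> bounds every root, and \<open>1\<close> makes that bound strict and the dilation contracting.\<close>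
  define lam where "lam = 1 + M + 2 * C"
  have "C \<ge> 0" by (simp add: C_def)
  have root_le: "cmod \<beta> \<le> M" if "\<beta> \<in># proots F" for \<beta>
    using that unfolding M_def by (intro member_le_sum) auto
  have "M \<ge> 0"
    unfolding M_def by (rule sum_nonneg) simp
  have lam: "lam \<ge> 1" "lam > M" "lam \<ge> 2 * C"
    using \<open>C \<ge> 0\<close> \<open>M \<ge> 0\<close> by (auto simp: lam_def)
  define c :: complex where "c = 1 / of_real lam ^ 2"
  have norm_c: "cmod c = 1 / lam ^ 2"
    using lam(1) by (simp add: c_def norm_divide norm_power)
  have cofactor: "smult (1 / of_real lam ^ n) (blaschke_cofactor lam F) =
                    pcompose (conj_reciprocal F) [:0, c:]"
    using blaschke_cofactor_eq_dilation[of lam F] root_le lam assms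
    by (force simp: c_def)
  have "cmod c \<le> 1"
    using lam(1) one_le_power[of lam 2] by (simp add: norm_c)
  moreover have "c \<noteq> 0"
    using lam(1) by (simp add: c_def)
  ultimately have "(dirichlet_norm (pcompose (conj_reciprocal F) [:0, c:]))\<^sup>2 \<le> (cmod c)\<^sup>2 * C"
    unfolding C_def by (rule dirichlet_norm_dilation_le)
  also have "(cmod c)\<^sup>2 * C = C / lam ^ 4"
    by (simp add: norm_c power_divide flip: power_mult)
  also have "\<dots> \<le> 1 / 2"
    using lam(1,3) self_le_power[of lam 4] by (simp add: field_simps)
  also have "1 / 2 \<le> 1 / 2 * real (degree F)"
    using False assms(2) by simp
  also have "\<dots> \<le> 1 / 2 * (dirichlet_norm F)\<^sup>2"
    using dirichlet_norm_ge_lead_coeff[of F] assms(1) by simp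
  finally have "(dirichlet_norm (smult (1 / of_real lam ^ n) (blaschke_cofactor lam F)))\<^sup>2
                  \<le> 1 / 2 * (dirichlet_norm F)\<^sup>2"
    by (simp only: cofactor)
  then show ?thesis
    using lam(1) by (intro exI[of _ lam]) auto
qed

end
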